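(* Let $X$ be a measurable space and let $H$ be a separable infinite-dimensional Hilbert space with a fixed orthonormal basis $(e_i)_{i\in\mathbb{N}}$. Let $f_i:X\to[0,1]$, $i\in\mathbb{N}$, be measurable functions. Define functions $a,b:X\to[0,\infty]$ by \[ a(x)=\sum_{i\in\mathbb{N}:\, f_i(x)\le \frac12} f_i(x)\quad\text{and}\quad b(x)=\sum_{i\in\mathbb{N}:\, f_i(x)>\frac12}(1-f_i(x)),\qquad x\in X. \] Assume that for every $x\in X$ we have either (i) $a(x)=\infty$ or $b(x)=\infty$, or (ii) $a(x),b(x)<\infty$ and $a(x)-b(x)\in\mathbb{Z}$. Then there exists a measurable projection $P:X\to\mathcal{B}(H)$ with diagonal $(f_i)_{i\in\mathbb{N}}$.
   Context: $\mathbb{N}=\{1,2,\dots\}$, and $\mathcal{B}(H)$ denotes the bounded operators on $H$. A map $P:X\to\mathcal{B}(H)$ is a measurable projection if $P(x)$ is an orthogonal projection for every $x\in X$ and $P$ is weakly operator measurable, i.e. $x\mapsto\langle P(x)u,v\rangle$ is measurable for all $u,v\in H$ (equivalently, all matrix entries of $P(x)$ with respect to the basis $(e_i)$ are measurable functions of $x$). The diagonal of $P$ is the sequence of measurable functions $(\langle P(x)e_i,e_i\rangle)_{i\in\mathbb{N}}$; thus $P$ has diagonal $(f_i)_{i\in\mathbb{N}}$ if $\langle P(x)e_i,e_i\rangle=f_i(x)$ for all $x\in X$ and $i\in\mathbb{N}$. *)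

theory Defs
  imports "HOL-Analysis.Analysis"
begin

text \<open>
  A complex Hilbert space is a real one (with inner product \<open>Re \<langle>x, y\<rangle>\<close>, hence the same norm)
  together with a compatible multiplication by complex scalars and a sesquilinear inner product,
  linear in the first argument. Positive definiteness of \<open>cinner\<close> is inherited from \<open>inner\<close>.
\<close>

class complex_inner = real_inner +
  fixes scaleC :: "complex \<Rightarrow> 'a \<Rightarrow> 'a"
    and cinner :: "'a \<Rightarrow> 'a \<Rightarrow> complex"
  assumes scaleC_add_right: "scaleC c (x + y) = scaleC c x + scaleC c y"
    and scaleC_add_left: "scaleC (c + d) x = scaleC c x + scaleC d x"
    and scaleC_scaleC: "scaleC c (scaleC d x) = scaleC (c * d) x"
    and scaleR_scaleC: "scaleR r x = scaleC (complex_of_real r) x"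
    and cinner_add_left: "cinner (x + y) z = cinner x z + cinner y z"
    and cinner_scaleC_left: "cinner (scaleC c x) y = c * cinner x y"
    and cinner_commute: "cinner x y = cnj (cinner y x)"
    and inner_eq_Re_cinner: "inner x y = Re (cinner x y)"

class complex_hilbert_space = complex_inner + complete_space

lemma vector_space_scaleC:
  "vector_space (scaleC :: complex \<Rightarrow> 'h::complex_inner \<Rightarrow> 'h)"
proof
  fix x :: 'h
  show "scaleC 1 x = x"
    using scaleR_scaleC[of 1 x] by simp
qed (simp_all add: scaleC_add_right scaleC_add_left scaleC_scaleC)

lemma cinner_self: "cinner x x = complex_of_real ((norm x)\<^sup>2)"
  for x :: "'h::complex_inner"
proof (rule complex_eqI)
  show "Im (cinner x x) = Im (complex_of_real ((norm x)\<^sup>2))"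
    using arg_cong[OF cinner_commute[of x x], of Im] by simp
qed (simp add: power2_norm_eq_inner inner_eq_Re_cinner)

text \<open>
  The scalar multiplication and the inner product are parameters below, so that the same
  definitions serve real Hilbert spaces (\<open>scaleR\<close>, \<open>inner\<close>) and complex ones
  (\<open>scaleC\<close>, \<open>cinner\<close>). A space with an orthonormal basis indexed by \<open>nat\<close> is
  separable and infinite-dimensional.
\<close>

definition orthonormal_basis ::
    "('k::real_normed_field \<Rightarrow> 'h \<Rightarrow> 'h) \<Rightarrow> ('h \<Rightarrow> 'h \<Rightarrow> 'k) \<Rightarrow> (nat \<Rightarrow> 'h::real_inner) \<Rightarrow> bool"
  where "orthonormal_basis smul ip e \<longleftrightarrow>
    (\<forall>i j. ip (e i) (e j) = (if i = j then 1 else 0)) \<and>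
    closure (module.span smul (range e)) = UNIV"

text \<open>
  Elements of \<^typ>\<open>'h \<Rightarrow>\<^sub>L 'h\<close> are bounded and only real-linear; the first clause
  makes the operator linear over the scalar field (it is automatic for \<open>scaleR\<close>).
\<close>

definition orthogonal_projection ::
    "('k::real_normed_field \<Rightarrow> 'h \<Rightarrow> 'h) \<Rightarrow> ('h \<Rightarrow> 'h \<Rightarrow> 'k) \<Rightarrow> ('h::real_inner \<Rightarrow>\<^sub>L 'h) \<Rightarrow> bool"
  where "orthogonal_projection smul ip T \<longleftrightarrow>
    (\<forall>c u. T (smul c u) = smul c (T u)) \<and>
    (\<forall>u. T (T u) = T u) \<and>
    (\<forall>u v. ip (T u) v = ip u (T v))"

definition measurable_projection ::
    "'x measure \<Rightarrow> ('k::real_normed_field \<Rightarrow> 'h \<Rightarrow> 'h) \<Rightarrow> ('h \<Rightarrow> 'h \<Rightarrow> 'k) \<Rightarrow>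
      ('x \<Rightarrow> ('h::real_inner \<Rightarrow>\<^sub>L 'h)) \<Rightarrow> bool"
  where "measurable_projection M smul ip P \<longleftrightarrow>
    (\<forall>x\<in>space M. orthogonal_projection smul ip (P x)) \<and>
    (\<forall>u v. (\<lambda>x. ip (P x u) v) \<in> borel_measurable M)"

definition has_diagonal ::
    "'x measure \<Rightarrow> ('h \<Rightarrow> 'h \<Rightarrow> 'k::real_normed_field) \<Rightarrow> (nat \<Rightarrow> 'h) \<Rightarrow>
      ('x \<Rightarrow> ('h::real_inner \<Rightarrow>\<^sub>L 'h)) \<Rightarrow> (nat \<Rightarrow> 'x \<Rightarrow> real) \<Rightarrow> bool"
  where "has_diagonal M ip e P f \<longleftrightarrow>
    (\<forall>x\<in>space M. \<forall>i. ip (P x (e i)) (e i) = of_real (f i x))"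

definition lower_sum :: "(nat \<Rightarrow> 'x \<Rightarrow> real) \<Rightarrow> 'x \<Rightarrow> ennreal"
  where "lower_sum f x = (\<Sum>\<^sub>\<infinity>i\<in>{i. f i x \<le> 1 / 2}. ennreal (f i x))"

definition upper_sum :: "(nat \<Rightarrow> 'x \<Rightarrow> real) \<Rightarrow> 'x \<Rightarrow> ennreal"
  where "upper_sum f x = (\<Sum>\<^sub>\<infinity>i\<in>{i. f i x > 1 / 2}. ennreal (1 - f i x))"

end

theory Submission imports Defs begin

text \<open>
  The projection is built by undoing one rotation per basis vector, and everything is an
  explicit function of the diagonal \<open>d\<^sub>i = f\<^sub>i(x)\<close>, so that measurability comes for free.

  In a plane where a symmetric operator is diagonal with entries \<open>r\<close> and \<open>d\<close> in \<open>[0,1]\<close>, the pair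
  \<open>(r, d)\<close> is also the diagonal, in a suitably rotated orthonormal basis, of the operator with
  eigenvalues \<open>(r + d, 0)\<close> or, if \<open>r + d > 1\<close>, \<open>(r + d - 1, 1)\<close>. One eigenvalue is thus settled to
  be 0 or 1 and the other one, the new carry, stays in \<open>[0,1]\<close>. Starting with carry \<open>r\<^sub>0 = d\<^sub>0\<close> and
  carry vector \<open>c\<^sub>0 = e\<^sub>0\<close>, rotate the plane of \<open>c\<^sub>n\<close> and \<open>e\<^sub>n\<^sub>+\<^sub>1\<close> to obtain a settled vector \<open>g\<^sub>n\<close>
  with eigenvalue \<open>s\<^sub>n\<close> in \<open>{0, 1}\<close> and the next carry vector \<open>c\<^sub>n\<^sub>+\<^sub>1\<close> with eigenvalue \<open>r\<^sub>n\<^sub>+\<^sub>1\<close>. The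
  \<open>g\<^sub>n\<close> are orthonormal, and for \<open>i \<le> n\<close> (\<open>settled_sum_diagonal\<close>)
    \<open>(\<Sum>m<n. s\<^sub>m \<langle>g\<^sub>m, e\<^sub>i\<rangle>\<^sup>2) + r\<^sub>n \<langle>c\<^sub>n, e\<^sub>i\<rangle>\<^sup>2 = d\<^sub>i\<close>.
  The same identity with \<open>1 - s\<^sub>m\<close>, \<open>1 - r\<^sub>n\<close> and \<open>1 - d\<^sub>i\<close> follows because \<open>g\<^sub>0, \<dots>, g\<^sub>n\<^sub>-\<^sub>1, c\<^sub>n\<close> is an
  orthonormal basis of the span of \<open>e\<^sub>0, \<dots>, e\<^sub>n\<close>. So the projection onto the closed span of the
  \<open>g\<^sub>m\<close> with \<open>s\<^sub>m = 1\<close> has diagonal \<open>d\<close> if \<open>r\<^sub>n \<langle>c\<^sub>n, e\<^sub>i\<rangle>\<^sup>2\<close> gets arbitrarily small, and the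
  complement of the projection onto the closed span of the \<open>g\<^sub>m\<close> with \<open>s\<^sub>m = 0\<close> has diagonal \<open>d\<close> if
  \<open>(1 - r\<^sub>n) \<langle>c\<^sub>n, e\<^sub>i\<rangle>\<^sup>2\<close> does (\<open>retained_vec_diagonal\<close>).

  The hypothesis guarantees one of the two. If \<open>a\<close> or \<open>b\<close> is infinite, then
  \<open>\<Sum>i. min d\<^sub>i (1 - d\<^sub>i) = \<infinity>\<close>; each rotation shrinks \<open>\<langle>c\<^sub>n, e\<^sub>i\<rangle>\<^sup>2\<close> by a factor of at least
  \<open>1 + min d\<^sub>n\<^sub>+\<^sub>1 (1 - d\<^sub>n\<^sub>+\<^sub>1)\<close>, and the product of these factors diverges (\<open>carry_vec_fades\<close>). If
  \<open>a\<close> and \<open>b\<close> are finite and \<open>a - b\<close> is an integer, then \<open>r\<^sub>n\<close>, which is congruent to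
  \<open>d\<^sub>0 + \<dots> + d\<^sub>n\<close> modulo 1, approaches the integers, so it comes arbitrarily close to 1 or tends to
  0 (\<open>residue_fades\<close>); which one is decided by whether \<open>r\<^sub>n > 1/2\<close> infinitely often, a measurable
  condition on \<open>x\<close>.
\<close>

section \<open>Merging a diagonal into a carry\<close>

primrec carry :: "(nat \<Rightarrow> real) \<Rightarrow> nat \<Rightarrow> real" where
  "carry d 0 = d 0"
| "carry d (Suc n) =
    (if carry d n + d (Suc n) > 1 then carry d n + d (Suc n) - 1 else carry d n + d (Suc n))"

definition overflow :: "(nat \<Rightarrow> real) \<Rightarrow> nat \<Rightarrow> bool" where
  "overflow d n \<longleftrightarrow> carry d n + d (Suc n) > 1"

text \<open>
  The square of the cosine of the rotation angle. When the denominator is 0, both eigenvalues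
  agree and any angle would do; division by zero then selects 0, which exchanges the two vectors.
\<close>

definition cos_sq :: "(nat \<Rightarrow> real) \<Rightarrow> nat \<Rightarrow> real" where
  "cos_sq d n = (if overflow d n then (1 - carry d n) / ((1 - carry d n) + (1 - d (Suc n)))
                 else carry d n / (carry d n + d (Suc n)))"

lemma carry_bounds:
  assumes "\<And>i. d i \<in> {0..1}"
  shows "0 \<le> carry d n" "carry d n \<le> 1"
proof -
  have "0 \<le> carry d n \<and> carry d n \<le> 1"
  proof (induction n)
    case 0
    then show ?case using assms[of 0] by simp
  next
    case (Suc n)
    then show ?case using assms[of "Suc n"] by auto
  qed
  then show "0 \<le> carry d n" "carry d n \<le> 1" by auto
qed

lemma carry_cong_sum: "carry d n - (\<Sum>i\<le>n. d i) \<in> \<int>"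
proof (induction n)
  case (Suc n)
  have "carry d (Suc n) - (\<Sum>i\<le>Suc n. d i)
      = carry d n - (\<Sum>i\<le>n. d i) - (if overflow d n then 1 else 0)"
    by (simp add: overflow_def)
  also have "\<dots> \<in> \<int>"
    by (rule Ints_diff[OF Suc]) auto
  finally show ?case .
qed simp

text \<open>
  The last two facts say that the rotation turns the eigenvalues, \<open>of_bool (overflow d n)\<close> and
  \<open>carry d (Suc n)\<close>, into the diagonal entries \<open>carry d n\<close> and \<open>d (Suc n)\<close>.
\<close>

lemma
  assumes d: "\<And>i. d i \<in> {0..1}"
  shows cos_sq_nonneg: "0 \<le> cos_sq d n" and cos_sq_le_1: "cos_sq d n \<le> 1"
    and cos_sq_decay: "cos_sq d n * (1 + min (d (Suc n)) (1 - d (Suc n))) \<le> 1"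
    and rotation_old: "of_bool (overflow d n) * (1 - cos_sq d n) + carry d (Suc n) * cos_sq d n = carry d n"
    and rotation_new: "of_bool (overflow d n) * cos_sq d n + carry d (Suc n) * (1 - cos_sq d n) = d (Suc n)"
proof -
  define r t where "r = carry d n" and "t = d (Suc n)"
  have r: "0 \<le> r" "r \<le> 1" and t: "0 \<le> t" "t \<le> 1"
    using carry_bounds[OF d, where ?n=n] d[of "Suc n"] by (auto simp: r_def t_def)
  \<comment> \<open>The two cases are exchanged by passing to \<open>1 - r\<close> and \<open>1 - t\<close>, so one computation serves both.\<close>
  have key: "0 \<le> k \<and> k \<le> 1 \<and> k * (1 + q) \<le> 1 \<and> (p + q) * k = p \<and> (p + q) * (1 - k) = q"
    if "0 \<le> p" "p \<le> 1" "0 \<le> q" "k = p / (p + q)" for p q k :: real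
  proof (cases "p + q = 0")
    case False
    with that have pos: "p + q > 0" by auto
    have "p * q \<le> q" using that by (simp add: mult_left_le_one_le)
    then have "p * (1 + q) \<le> p + q" by (simp add: distrib_left)
    then have "k * (1 + q) \<le> 1" using pos that(4) by simp
    moreover have kp: "(p + q) * k = p" using pos that(4) by simp
    moreover have "(p + q) * (1 - k) = q" using kp by (simp only: right_diff_distrib) simp
    moreover have "0 \<le> k" "k \<le> 1" using pos that by (simp_all only: that(4)) simp_all
    ultimately show ?thesis by blast
  qed (use that in auto)
  have m: "k * (1 + min t (1 - t)) \<le> 1" if "0 \<le> k" "k * (1 + q) \<le> 1" "q = t \<or> q = 1 - t" for k q
  proof -
    have "k * (1 + min t (1 - t)) \<le> k * (1 + q)"
      using that by (intro mult_left_mono) auto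
    then show ?thesis using that by simp
  qed
  have "0 \<le> cos_sq d n \<and> cos_sq d n \<le> 1 \<and> cos_sq d n * (1 + min t (1 - t)) \<le> 1 \<and>
    of_bool (overflow d n) * (1 - cos_sq d n) + carry d (Suc n) * cos_sq d n = r \<and>
    of_bool (overflow d n) * cos_sq d n + carry d (Suc n) * (1 - cos_sq d n) = t"
  proof (cases "overflow d n")
    case True
    define k where "k = cos_sq d n"
    have k: "k = (1 - r) / ((1 - r) + (1 - t))"
      using True by (simp add: k_def cos_sq_def r_def t_def)
    have *: "0 \<le> k \<and> k \<le> 1 \<and> k * (1 + (1 - t)) \<le> 1 \<and> ((1 - r) + (1 - t)) * k = 1 - r
        \<and> ((1 - r) + (1 - t)) * (1 - k) = 1 - t"
      by (rule key) (use r t k in auto)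
    moreover have "carry d (Suc n) = r + t - 1"
      using True by (simp add: overflow_def r_def t_def)
    moreover have "k * (1 + min t (1 - t)) \<le> 1" using * m by blast
    moreover have "1 * (1 - k) + (r + t - 1) * k = r"
      using conjunct1[OF conjunct2[OF conjunct2[OF conjunct2[OF *]]]] by (simp add: algebra_simps)
    moreover have "1 * k + (r + t - 1) * (1 - k) = t"
      using * by argo
    moreover have "of_bool (overflow d n) = (1 :: real)"
      using True by simp
    ultimately show ?thesis unfolding k_def[symmetric] by metis
  next
    case False
    define k where "k = cos_sq d n"
    have k: "k = r / (r + t)"
      using False by (simp add: k_def cos_sq_def r_def t_def)
    have *: "0 \<le> k \<and> k \<le> 1 \<and> k * (1 + t) \<le> 1 \<and> (r + t) * k = r \<and> (r + t) * (1 - k) = t"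
      by (rule key) (use r t k in auto)
    moreover have "carry d (Suc n) = r + t"
      using False by (simp add: overflow_def r_def t_def)
    moreover have "k * (1 + min t (1 - t)) \<le> 1" using * m by blast
    moreover have "of_bool (overflow d n) = (0 :: real)"
      using False by simp
    ultimately show ?thesis unfolding k_def[symmetric] by simp
  qed
  then show "0 \<le> cos_sq d n" "cos_sq d n \<le> 1" "cos_sq d n * (1 + min (d (Suc n)) (1 - d (Suc n))) \<le> 1"
    "of_bool (overflow d n) * (1 - cos_sq d n) + carry d (Suc n) * cos_sq d n = carry d n"
    "of_bool (overflow d n) * cos_sq d n + carry d (Suc n) * (1 - cos_sq d n) = d (Suc n)"
    by (auto simp: r_def t_def)
qed

section \<open>The rotated orthonormal system\<close>

primrec carry_vec :: "(nat \<Rightarrow> 'h::real_inner) \<Rightarrow> (nat \<Rightarrow> real) \<Rightarrow> nat \<Rightarrow> 'h" where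
  "carry_vec e d 0 = e 0"
| "carry_vec e d (Suc n) =
    sqrt (cos_sq d n) *\<^sub>R carry_vec e d n + sqrt (1 - cos_sq d n) *\<^sub>R e (Suc n)"

definition settled_vec :: "(nat \<Rightarrow> 'h::real_inner) \<Rightarrow> (nat \<Rightarrow> real) \<Rightarrow> nat \<Rightarrow> 'h" where
  "settled_vec e d n =
    sqrt (cos_sq d n) *\<^sub>R e (Suc n) - sqrt (1 - cos_sq d n) *\<^sub>R carry_vec e d n"

context
  fixes e :: "nat \<Rightarrow> 'h::real_inner" and d :: "nat \<Rightarrow> real"
  assumes e: "\<And>i j. inner (e i) (e j) = (if i = j then 1 else 0)"
    and d: "\<And>i. d i \<in> {0..1}"
begin

lemma abs_cos_sq [simp]:
  "\<bar>cos_sq d n\<bar> = cos_sq d n" "\<bar>1 - cos_sq d n\<bar> = 1 - cos_sq d n"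
  using cos_sq_nonneg[OF d, where ?n=n] cos_sq_le_1[OF d, where ?n=n] by auto

lemma carry_vec_orth_later: "n < i \<Longrightarrow> inner (carry_vec e d n) (e i) = 0"
  by (induction n) (auto simp: e inner_add_left inner_add_right inner_diff_left inner_diff_right)

lemma carry_vec_orth_later': "n < i \<Longrightarrow> inner (e i) (carry_vec e d n) = 0"
  using carry_vec_orth_later[of n i] by (simp add: inner_commute)

lemma inner_carry_vec_self: "inner (carry_vec e d n) (carry_vec e d n) = 1"
proof (induction n)
  case (Suc n)
  then show ?case
    by (simp add: e inner_add_left inner_add_right inner_diff_left inner_diff_right carry_vec_orth_later carry_vec_orth_later')
qed (simp add: e)

lemma inner_settled_vec_self: "inner (settled_vec e d n) (settled_vec e d n) = 1"
  by (simp add: settled_vec_def e inner_add_left inner_add_right inner_diff_left inner_diff_right carry_vec_orth_later carry_vec_orth_later'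
      inner_carry_vec_self)

lemma settled_vec_orth_later: "Suc n < i \<Longrightarrow> inner (settled_vec e d n) (e i) = 0"
  by (simp add: settled_vec_def inner_add_left inner_add_right inner_diff_left inner_diff_right e carry_vec_orth_later)

lemma settled_vec_orth_carry_vec: "m < n \<Longrightarrow> inner (settled_vec e d m) (carry_vec e d n) = 0"
proof (induction n)
  case (Suc n)
  show ?case
  proof (cases "m = n")
    case True
    then show ?thesis
      by (simp add: settled_vec_def e inner_add_left inner_add_right inner_diff_left inner_diff_right carry_vec_orth_later carry_vec_orth_later'
        inner_carry_vec_self)
  next
    case False
    with Suc show ?thesis by (simp add: inner_add_left inner_add_right inner_diff_left inner_diff_right settled_vec_orth_later)
  qed
qed simp

lemma settled_vec_orthonormal:
  "inner (settled_vec e d m) (settled_vec e d n) = (if m = n then 1 else 0)"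
proof -
  have *: "inner (settled_vec e d m) (settled_vec e d n) = 0" if "m < n" for m n
    by (subst (2) settled_vec_def)
      (use that in \<open>simp add: inner_add_left inner_add_right inner_diff_left inner_diff_right settled_vec_orth_later settled_vec_orth_carry_vec\<close>)
  show ?thesis
    using *[of m n] *[of n m] inner_settled_vec_self
    by (cases m n rule: linorder_cases) (auto simp: inner_commute)
qed

lemma inner_carry_vec_Suc_old:
  "i \<le> n \<Longrightarrow> (inner (carry_vec e d (Suc n)) (e i))\<^sup>2 = cos_sq d n * (inner (carry_vec e d n) (e i))\<^sup>2"
  using cos_sq_nonneg[OF d, where ?n=n]
  by (simp add: inner_add_left inner_add_right inner_diff_left inner_diff_right e power_mult_distrib)

lemma inner_settled_vec_old:
  "i \<le> n \<Longrightarrow> (inner (settled_vec e d n) (e i))\<^sup>2 = (1 - cos_sq d n) * (inner (carry_vec e d n) (e i))\<^sup>2"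
  using cos_sq_le_1[OF d, where ?n=n]
  by (simp add: settled_vec_def inner_add_left inner_add_right inner_diff_left inner_diff_right e power_mult_distrib)

lemma inner_vecs_new:
  "(inner (carry_vec e d (Suc n)) (e (Suc n)))\<^sup>2 = 1 - cos_sq d n"
  "(inner (settled_vec e d n) (e (Suc n)))\<^sup>2 = cos_sq d n"
  using cos_sq_le_1[OF d, where ?n=n] cos_sq_nonneg[OF d, where ?n=n]
  by (simp_all add: settled_vec_def inner_add_left inner_add_right inner_diff_left inner_diff_right e carry_vec_orth_later)

text \<open>
  Parseval's identity for \<open>e i\<close> in the orthonormal basis of the span of the first basis vectors
  that consists of the settled vectors and the carry vector.
\<close>

lemma settled_sum_unit:
  "i \<le> n \<Longrightarrow> (\<Sum>m<n. (inner (settled_vec e d m) (e i))\<^sup>2) + (inner (carry_vec e d n) (e i))\<^sup>2 = 1"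
proof (induction n)
  case (Suc n)
  show ?case
  proof (cases "i = Suc n")
    case True
    then show ?thesis by (simp add: settled_vec_orth_later inner_vecs_new del: carry_vec.simps)
  next
    case False
    with Suc show ?thesis
      by (simp add: inner_carry_vec_Suc_old inner_settled_vec_old algebra_simps del: carry_vec.simps)
  qed
qed (simp add: e)

text \<open>
  The invariant of the construction: after \<open>n\<close> rotations, the operator with the settled
  eigenvalues and the carry has the prescribed first diagonal entries.
\<close>

lemma settled_sum_diagonal:
  "i \<le> n \<Longrightarrow> (\<Sum>m<n. of_bool (overflow d m) * (inner (settled_vec e d m) (e i))\<^sup>2)
    + carry d n * (inner (carry_vec e d n) (e i))\<^sup>2 = d i"
proof (induction n)
  case (Suc n)
  show ?case
  proof (cases "i = Suc n")
    case True
    then show ?thesis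
      using rotation_new[OF d, where ?n=n]
      by (simp add: settled_vec_orth_later inner_vecs_new del: carry_vec.simps carry.simps)
  next
    case False
    have "of_bool (overflow d n) * (inner (settled_vec e d n) (e i))\<^sup>2
        + carry d (Suc n) * (inner (carry_vec e d (Suc n)) (e i))\<^sup>2
      = (of_bool (overflow d n) * (1 - cos_sq d n) + carry d (Suc n) * cos_sq d n)
        * (inner (carry_vec e d n) (e i))\<^sup>2"
      using False Suc.prems
      by (simp add: inner_carry_vec_Suc_old inner_settled_vec_old algebra_simps
          del: carry_vec.simps carry.simps)
    also have "\<dots> = carry d n * (inner (carry_vec e d n) (e i))\<^sup>2"
      by (simp only: rotation_old[OF d])
    finally show ?thesis
      using Suc False by (simp del: carry_vec.simps carry.simps)
  qed
qed (simp add: e)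

end

section \<open>The carry fades out\<close>

definition mostly_high :: "(nat \<Rightarrow> real) \<Rightarrow> bool" where
  "mostly_high d \<longleftrightarrow> (\<forall>N. \<exists>n\<ge>N. carry d n > 1 / 2)"

text \<open>
  The eigenvalue at the carry vector that the limit operator loses: that of the operator
  itself or, when the carry keeps returning to the upper half of the unit interval, that of its
  complement.
\<close>

definition residue :: "(nat \<Rightarrow> real) \<Rightarrow> nat \<Rightarrow> real" where
  "residue d n = (if mostly_high d then 1 - carry d n else carry d n)"

definition lower_part :: "(nat \<Rightarrow> real) \<Rightarrow> nat \<Rightarrow> real" where
  "lower_part d i = (if d i \<le> 1 / 2 then d i else 0)"

definition upper_part :: "(nat \<Rightarrow> real) \<Rightarrow> nat \<Rightarrow> real" where
  "upper_part d i = (if d i > 1 / 2 then 1 - d i else 0)"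

text \<open>
  The sum of \<open>min (d i) (1 - d i)\<close> is the sum of the lower and the upper part, so the first
  alternative says that one of these two sums is infinite.
\<close>

definition kadison_condition :: "(nat \<Rightarrow> real) \<Rightarrow> bool" where
  "kadison_condition d \<longleftrightarrow>
    \<not> summable (\<lambda>i. min (d i) (1 - d i)) \<or>
    summable (lower_part d) \<and> summable (upper_part d) \<and>
    suminf (lower_part d) - suminf (upper_part d) \<in> \<int>"

text \<open>
  The bound \<open>cos_sq_decay\<close> at each rotation, together with \<open>\<Prod>(1 + m\<^sub>k) \<ge> 1 + \<Sum>m\<^sub>k\<close>, makes the
  coordinates of the carry vector at most the reciprocal of \<open>1 + \<Sum>m\<^sub>k\<close>.
\<close>

lemma carry_vec_fades:
  fixes e :: "nat \<Rightarrow> 'h::real_inner"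
  assumes e: "\<And>i j. inner (e i) (e j) = (if i = j then 1 else 0)"
    and d: "\<And>i. d i \<in> {0..1}"
    and diverges: "\<not> summable (\<lambda>i. min (d i) (1 - d i))" and "\<epsilon> > 0"
  shows "\<exists>n\<ge>i. (inner (carry_vec e d n) (e i))\<^sup>2 \<le> \<epsilon>"
proof -
  define u where "u n = (inner (carry_vec e d n) (e i))\<^sup>2" for n
  define m where "m k = min (d k) (1 - d k)" for k
  \<comment> \<open>The coordinate at \<open>i\<close> only starts to shrink with the rotation that follows the arrival of \<open>e i\<close>.\<close>
  define S where "S k = (\<Sum>j<k. m (j + Suc i))" for k
  have m_nonneg: "0 \<le> m k" for k
    using d[of k] by (auto simp: m_def)
  have S_nonneg: "0 \<le> S k" for k
    unfolding S_def by (intro sum_nonneg m_nonneg)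
  have bound: "u (k + i) * (1 + S k) \<le> 1" for k
  proof (induction k)
    case 0
    have "0 \<le> (\<Sum>m<i. (inner (settled_vec e d m) (e i))\<^sup>2)"
      by (intro sum_nonneg) auto
    then show ?case
      using settled_sum_unit[where d = d and i = i and n = i, OF e d] by (simp add: u_def S_def)
  next
    case (Suc k)
    let ?c = "cos_sq d (k + i)" and ?m = "m (Suc (k + i))"
    have u: "u (Suc (k + i)) = ?c * u (k + i)"
      unfolding u_def by (rule inner_carry_vec_Suc_old[where d = d, OF e d]) auto
    have c: "?c * (1 + ?m) \<le> 1"
      unfolding m_def by (rule cos_sq_decay[OF d])
    have "u (Suc (k + i)) * (1 + S (Suc k)) \<le> u (Suc (k + i)) * ((1 + ?m) * (1 + S k))"
    proof (rule mult_left_mono)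
      have "0 \<le> ?m * S k" using m_nonneg S_nonneg by simp
      then show "1 + S (Suc k) \<le> (1 + ?m) * (1 + S k)"
        by (simp add: S_def distrib_left distrib_right)
    qed (simp add: u_def)
    also have "\<dots> = (?c * (1 + ?m)) * (u (k + i) * (1 + S k))"
      unfolding u by (simp only: ac_simps)
    also have "\<dots> \<le> 1 * 1"
      using S_nonneg[of k] m_nonneg cos_sq_nonneg[OF d]
      by (intro mult_mono c Suc) (auto simp: u_def)
    finally show ?case by simp
  qed
  have "\<exists>k. S k > 1 / \<epsilon>"
  proof (rule ccontr)
    assume "\<not> (\<exists>k. S k > 1 / \<epsilon>)"
    then have "summable (\<lambda>j. m (j + Suc i))"
      using m_nonneg by (intro summableI_nonneg_bounded[where x = "1 / \<epsilon>"]) (auto simp: S_def not_less)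
    then have "summable m" by (simp only: summable_iff_shift)
    then show False using diverges by (simp add: m_def[abs_def])
  qed
  then obtain k where k: "S k > 1 / \<epsilon>" by blast
  have "u (k + i) * (1 / \<epsilon>) \<le> u (k + i) * (1 + S k)"
    using k by (intro mult_left_mono) (auto simp: u_def)
  also have "\<dots> \<le> 1" by (rule bound)
  finally have "u (k + i) \<le> \<epsilon>" using \<open>\<epsilon> > 0\<close> by (simp add: field_simps)
  then show ?thesis unfolding u_def by (intro exI[of _ "k + i"]) auto
qed

text \<open>
  Modulo 1 the carry is the partial sum of the diagonal, hence that of the lower minus the upper
  part, and these differences converge to an integer. The carry is therefore close to 0 or to 1,
  and the side of 1/2 on which it lies tells which.
\<close>

lemma residue_fades:
  assumes d: "\<And>i. d i \<in> {0..1}"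
    and l: "summable (lower_part d)" and u: "summable (upper_part d)"
    and int: "suminf (lower_part d) - suminf (upper_part d) \<in> \<int>"
    and "\<epsilon> > 0"
  shows "\<exists>n\<ge>N. residue d n \<le> \<epsilon>"
proof -
  \<comment> \<open>\<open>\<delta> n\<close> is a null sequence that differs from \<open>carry d n\<close> by an integer.\<close>
  define \<delta> where "\<delta> n = (\<Sum>i\<le>n. lower_part d i) - (\<Sum>i\<le>n. upper_part d i) - (suminf (lower_part d) - suminf (upper_part d))" for n
  have "(\<lambda>n. (\<Sum>i\<le>n. lower_part d i) - (\<Sum>i\<le>n. upper_part d i)) \<longlonglongrightarrow> suminf (lower_part d) - suminf (upper_part d)"
    using l u by (intro tendsto_diff summable_LIMSEQ')
  then have "\<delta> \<longlonglongrightarrow> 0"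
    unfolding \<delta>_def by (simp add: LIM_zero_iff)
  then have "\<forall>\<^sub>F n in sequentially. dist (\<delta> n) 0 < min \<epsilon> (1 / 2)"
    using \<open>\<epsilon> > 0\<close> by (intro tendstoD) auto
  then obtain K where K: "\<And>n. n \<ge> K \<Longrightarrow> \<bar>\<delta> n\<bar> < min \<epsilon> (1 / 2)"
    unfolding eventually_sequentially by (auto simp: dist_real_def)
  have carry_int: "carry d n - \<delta> n \<in> \<int>" for n
  proof -
    have "(\<Sum>i\<le>n. d i) = (\<Sum>i\<le>n. lower_part d i - upper_part d i + of_bool (d i > 1 / 2))"
      by (intro sum.cong) (auto simp: lower_part_def upper_part_def)
    then have eq: "carry d n - \<delta> n = (carry d n - (\<Sum>i\<le>n. d i))
        + (\<Sum>i\<le>n. of_bool (d i > 1 / 2)) + (suminf (lower_part d) - suminf (upper_part d))"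
      unfolding \<delta>_def by (simp add: sum.distrib sum_subtractf)
    show ?thesis
      unfolding eq by (intro Ints_add carry_cong_sum int Ints_sum) auto
  qed
  show ?thesis
  proof (cases "mostly_high d")
    case True
    then obtain n where n: "n \<ge> max N K" "carry d n > 1 / 2"
      unfolding mostly_high_def by blast
    obtain j where j: "carry d n - \<delta> n = of_int j"
      using carry_int[of n] by (auto elim: Ints_cases)
    have "\<bar>\<delta> n\<bar> < min \<epsilon> (1 / 2)" using K n by simp
    then have \<delta>: "\<bar>\<delta> n\<bar> < \<epsilon>" "\<bar>\<delta> n\<bar> < 1 / 2" by auto
    then have "(0 :: real) < of_int j" using n j by linarith
    then have "(1 :: real) \<le> of_int j" by simp
    then have "1 - carry d n \<le> \<epsilon>" using j \<delta> by linarith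
    then show ?thesis using True n by (intro exI[of _ n]) (auto simp: residue_def)
  next
    case False
    then obtain K' where K': "\<And>n. n \<ge> K' \<Longrightarrow> carry d n \<le> 1 / 2"
      unfolding mostly_high_def by (auto simp: not_less)
    define n where "n = max N (max K K')"
    obtain j where j: "carry d n - \<delta> n = of_int j"
      using carry_int[of n] by (auto elim: Ints_cases)
    have "\<bar>\<delta> n\<bar> < min \<epsilon> (1 / 2)" using K[of n] by (simp add: n_def)
    then have \<delta>: "\<bar>\<delta> n\<bar> < \<epsilon>" "\<bar>\<delta> n\<bar> < 1 / 2" by auto
    moreover have "carry d n \<le> 1 / 2" using K'[of n] by (simp add: n_def)
    ultimately have "(of_int j :: real) < 1" using j by linarith
    then have "(of_int j :: real) \<le> 0" by simp
    then have "carry d n \<le> \<epsilon>" using j \<delta> by linarith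
    then show ?thesis using False by (intro exI[of _ n]) (auto simp: residue_def n_def)
  qed
qed

text \<open>
  Setting the discarded vectors to 0 keeps the index set, so that no measurable re-indexing is
  required. The retained vectors have as closed span the range of the projection or, if
  \<open>mostly_high d\<close>, its kernel.
\<close>

definition retained_vec :: "(nat \<Rightarrow> 'h::real_inner) \<Rightarrow> (nat \<Rightarrow> real) \<Rightarrow> nat \<Rightarrow> 'h" where
  "retained_vec e d m = (if overflow d m \<noteq> mostly_high d then settled_vec e d m else 0)"

text \<open>
  The partial sums increase and differ from the claimed limit by the residue times a squared
  coordinate of the carry vector; hence it is enough that this error is small at some places.
\<close>

lemma retained_vec_diagonal:
  fixes e :: "nat \<Rightarrow> 'h::real_inner"
  assumes e: "\<And>i j. inner (e i) (e j) = (if i = j then 1 else 0)"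
    and d: "\<And>i. d i \<in> {0..1}"
    and kad: "kadison_condition d"
  shows "(\<lambda>m. (inner (retained_vec e d m) (e i))\<^sup>2) sums (if mostly_high d then 1 - d i else d i)"
proof -
  define u where "u n = (inner (carry_vec e d n) (e i))\<^sup>2" for n
  define F where "F n = (\<Sum>m<n. (inner (retained_vec e d m) (e i))\<^sup>2)" for n
  define t where "t = (if mostly_high d then 1 - d i else d i)"
  have F_eq: "F n + residue d n * u n = t" if "i \<le> n" for n
  proof -
    let ?s = "\<lambda>m. (inner (settled_vec e d m) (e i))\<^sup>2"
    have "F n = (if mostly_high d then (\<Sum>m<n. ?s m) - (\<Sum>m<n. of_bool (overflow d m) * ?s m)
        else (\<Sum>m<n. of_bool (overflow d m) * ?s m))"
      unfolding F_def retained_vec_def sum_subtractf[symmetric]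
      by (cases "mostly_high d") (simp_all add: if_distrib[of "\<lambda>v. (inner v (e i))\<^sup>2"] of_bool_def
          if_distrib[of "\<lambda>r. r * _"] cong: if_cong, auto intro!: sum.cong)
    moreover have "(\<Sum>m<n. ?s m) + u n = 1"
      unfolding u_def by (rule settled_sum_unit[where d = d, OF e d that])
    moreover have "(\<Sum>m<n. of_bool (overflow d m) * ?s m) + carry d n * u n = d i"
      unfolding u_def by (rule settled_sum_diagonal[where d = d, OF e d that])
    ultimately show ?thesis
      by (simp add: residue_def t_def left_diff_distrib)
  qed
  have residue: "0 \<le> residue d n" "residue d n \<le> 1" for n
    using carry_bounds[OF d, where ?n=n] by (auto simp: residue_def)
  have u: "0 \<le> u n" "i \<le> n \<Longrightarrow> u n \<le> 1" for n
  proof -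
    show "0 \<le> u n" by (simp add: u_def)
    have "0 \<le> (\<Sum>m<n. (inner (settled_vec e d m) (e i))\<^sup>2)"
      by (intro sum_nonneg) auto
    then show "i \<le> n \<Longrightarrow> u n \<le> 1"
      using settled_sum_unit[where d = d and i = i and n = n, OF e d] by (simp add: u_def)
  qed
  have F_le: "F n \<le> t" if "i \<le> n" for n
    using F_eq[OF that] mult_nonneg_nonneg[OF residue(1) u(1), of n n] by linarith
  have "F \<longlonglongrightarrow> t"
  proof (rule increasing_LIMSEQ)
    show "F n \<le> F (Suc n)" for n by (simp add: F_def)
    show "F n \<le> t" for n
    proof -
      have "F n \<le> F (max n i)"
        unfolding F_def by (intro sum_mono2) auto
      then show ?thesis using F_le[of "max n i"] by simp
    qed
    show "\<exists>n. t \<le> F n + \<epsilon>" if "\<epsilon> > 0" for \<epsilon>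
    proof -
      have "\<exists>n\<ge>i. residue d n * u n \<le> \<epsilon>"
      proof (cases "summable (\<lambda>i. min (d i) (1 - d i))")
        case False
        then obtain n where n: "n \<ge> i" "u n \<le> \<epsilon>"
          using carry_vec_fades[where d = d, OF e d False \<open>\<epsilon> > 0\<close>] unfolding u_def by blast
        have "residue d n * u n \<le> 1 * u n"
          by (intro mult_right_mono residue u)
        then show ?thesis using n by auto
      next
        case True
        then obtain n where n: "n \<ge> i" "residue d n \<le> \<epsilon>"
          using residue_fades[where d = d, OF d _ _ _ \<open>\<epsilon> > 0\<close>] kad unfolding kadison_condition_def by blast
        have "residue d n * u n \<le> residue d n * 1"
          by (intro mult_left_mono residue u n)
        then show ?thesis using n by auto
      qed
      then obtain n where n: "n \<ge> i" "residue d n * u n \<le> \<epsilon>" by blast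
      with F_eq[of n] have "t \<le> F n + \<epsilon>" by linarith
      then show ?thesis ..
    qed
  qed
  then show ?thesis unfolding sums_def F_def t_def .
qed

section \<open>Projections onto closed spans of orthonormal systems\<close>

text \<open>
  By Pythagoras' theorem the partial sums are Cauchy as soon as the squared norms are summable.
\<close>

lemma summable_orthogonal:
  fixes w :: "nat \<Rightarrow> 'h::{real_inner, complete_space}"
  assumes orth: "\<And>m n. m \<noteq> n \<Longrightarrow> inner (w m) (w n) = 0"
    and bound: "\<And>n. norm (\<Sum>k<n. w k) \<le> B"
  shows "summable w"
proof -
  define S where "S n = (\<Sum>k<n. w k)" for n
  define Q where "Q n = (\<Sum>k<n. (norm (w k))\<^sup>2)" for n
  have pyth: "(norm (sum w I))\<^sup>2 = (\<Sum>k\<in>I. (norm (w k))\<^sup>2)" if "finite I" for I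
    using that orth by (intro norm_sum_Pythagorean) (auto simp: pairwise_def orthogonal_def)
  have "summable (\<lambda>k. (norm (w k))\<^sup>2)"
  proof (rule summableI_nonneg_bounded)
    show "(\<Sum>k<n. (norm (w k))\<^sup>2) \<le> B\<^sup>2" for n
      unfolding pyth[OF finite_lessThan, symmetric] by (intro power_mono bound) auto
  qed simp
  then have "Cauchy Q"
    unfolding Q_def by (intro convergent_Cauchy) (simp add: summable_iff_convergent)
  have diff: "(norm (S m - S n))\<^sup>2 \<le> \<bar>Q m - Q n\<bar>" if "n \<le> m" for m n
  proof -
    have "S m - S n = sum w {n..<m}" "Q m - Q n = (\<Sum>k\<in>{n..<m}. (norm (w k))\<^sup>2)"
      using that by (simp_all add: S_def Q_def sum_diff_nat_ivl lessThan_atLeast0)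
    then show ?thesis using pyth[of "{n..<m}"] by simp
  qed
  have "Cauchy S"
  proof (rule metric_CauchyI)
    fix \<epsilon> :: real assume "\<epsilon> > 0"
    then have "\<epsilon>\<^sup>2 > 0" by simp
    then obtain K where K: "\<And>m n. m \<ge> K \<Longrightarrow> n \<ge> K \<Longrightarrow> dist (Q m) (Q n) < \<epsilon>\<^sup>2"
      using metric_CauchyD[OF \<open>Cauchy Q\<close>] by meson
    have *: "dist (S m) (S n) < \<epsilon>" if "m \<ge> K" "n \<ge> K" "n \<le> m" for m n
    proof -
      have "(dist (S m) (S n))\<^sup>2 < \<epsilon>\<^sup>2"
        using diff[OF \<open>n \<le> m\<close>] K[of m n] that by (simp add: dist_norm)
      then show ?thesis using \<open>\<epsilon> > 0\<close> by (simp add: power_less_imp_less_base)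
    qed
    show "\<exists>K. \<forall>m\<ge>K. \<forall>n\<ge>K. dist (S m) (S n) < \<epsilon>"
      using * by (metis dist_commute nle_le)
  qed
  then show ?thesis
    unfolding summable_iff_convergent S_def by (rule Cauchy_convergent)
qed

text \<open>
  The part of the theory of Hilbert spaces common to the real and the complex scalars. The
  condition \<open>ip_smul_right\<close> expresses conjugate linearity of \<open>ip\<close> in its second argument without
  naming the conjugation: for a complex scalar product, \<open>ip v u\<close> is the conjugate of \<open>ip u v\<close>.
\<close>

locale scalar_product_space =
  fixes smul :: "'k::{real_normed_field, second_countable_topology}
      \<Rightarrow> 'h::{real_inner, complete_space} \<Rightarrow> 'h"
    and ip :: "'h \<Rightarrow> 'h \<Rightarrow> 'k"
  assumes bounded_bilinear_smul: "bounded_bilinear smul"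
    and bounded_bilinear_ip: "bounded_bilinear ip"
    and smul_smul: "smul (a * b) x = smul a (smul b x)"
    and ip_smul_left: "ip (smul c x) y = c * ip x y"
    and ip_smul_right: "ip x (smul (ip u v) y) = ip v u * ip x y"
    and inner_eq_of_ip: "ip x y = of_real r \<Longrightarrow> inner x y = r"
begin

sublocale smul: bounded_bilinear smul by (rule bounded_bilinear_smul)
sublocale ip: bounded_bilinear ip by (rule bounded_bilinear_ip)

definition orthonormal_or_zero :: "(nat \<Rightarrow> 'h) \<Rightarrow> bool" where
  "orthonormal_or_zero g \<longleftrightarrow> (\<forall>m n. ip (g m) (g n) = (if m = n \<and> g m \<noteq> 0 then 1 else 0))"

definition span_proj :: "(nat \<Rightarrow> 'h) \<Rightarrow> 'h \<Rightarrow> 'h" where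
  "span_proj g u = (\<Sum>n. smul (ip u (g n)) (g n))"

context
  fixes g assumes g: "orthonormal_or_zero g"
begin

text \<open>
  Each component of \<open>u\<close> is orthogonal to the remainder of \<open>u\<close>.
\<close>

lemma component_inner: "inner u (smul (ip u (g n)) (g n)) = (norm (smul (ip u (g n)) (g n)))\<^sup>2"
proof -
  let ?w = "smul (ip u (g n)) (g n)"
  have "ip (u - ?w) ?w = 0"
    using g by (cases "g n = 0")
      (auto simp: ip.diff_left ip_smul_left ip_smul_right orthonormal_or_zero_def
        smul.zero_right ip.zero_right)
  then have "inner (u - ?w) ?w = 0" by (intro inner_eq_of_ip) simp
  then show ?thesis by (simp add: inner_diff_left power2_norm_eq_inner)
qed

lemma components_orthogonal:
  "m \<noteq> n \<Longrightarrow> inner (smul (ip u (g m)) (g m)) (smul (ip u (g n)) (g n)) = 0"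
  using g by (intro inner_eq_of_ip)
    (simp add: ip_smul_left ip_smul_right orthonormal_or_zero_def)

lemma bessel: "norm (\<Sum>k<n. smul (ip u (g k)) (g k)) \<le> norm u"
proof -
  let ?w = "\<lambda>k. smul (ip u (g k)) (g k)"
  let ?S = "\<Sum>k<n. ?w k"
  have "(norm ?S)\<^sup>2 = (\<Sum>k<n. (norm (?w k))\<^sup>2)"
    using components_orthogonal
    by (intro norm_sum_Pythagorean) (auto simp: pairwise_def orthogonal_def)
  also have "\<dots> = inner u ?S"
    by (simp add: inner_sum_right component_inner)
  also have "\<dots> \<le> norm u * norm ?S"
    by (rule norm_cauchy_schwarz)
  finally show ?thesis
    by (cases "?S = 0") (simp_all add: power2_eq_square)
qed

lemma span_proj_sums: "(\<lambda>n. smul (ip u (g n)) (g n)) sums span_proj g u"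
  unfolding span_proj_def
  by (intro summable_sums summable_orthogonal[where B = "norm u"] components_orthogonal bessel)

lemma bounded_linear_span_proj: "bounded_linear (span_proj g)"
proof (rule bounded_linear_intro[where K = 1])
  show "span_proj g (u + v) = span_proj g u + span_proj g v" for u v
    using sums_add[OF span_proj_sums[of u] span_proj_sums[of v]] span_proj_sums[of "u + v"]
    by (auto simp: ip.add_left smul.add_left intro: sums_unique2)
  show "span_proj g (r *\<^sub>R u) = r *\<^sub>R span_proj g u" for r u
    using sums_scaleR_right[OF span_proj_sums[of u], of r] span_proj_sums[of "r *\<^sub>R u"]
    by (auto simp: ip.scaleR_left smul.scaleR_left intro: sums_unique2)
  have "(\<lambda>n. norm (\<Sum>k<n. smul (ip u (g k)) (g k))) \<longlonglongrightarrow> norm (span_proj g u)" for u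
    using span_proj_sums[of u] unfolding sums_def by (rule tendsto_norm)
  then show "norm (span_proj g u) \<le> norm u * 1" for u
    unfolding mult_1_right by (rule LIMSEQ_le_const2) (use bessel in blast)
qed

lemma ip_span_proj: "(\<lambda>n. ip u (g n) * ip (g n) v) sums ip (span_proj g u) v"
  using bounded_linear.sums[OF ip.bounded_linear_left span_proj_sums, of u v]
  by (simp add: ip_smul_left)

lemma span_proj_selfadjoint: "ip (span_proj g u) v = ip u (span_proj g v)"
proof -
  have "(\<lambda>n. ip u (g n) * ip (g n) v) sums ip u (span_proj g v)"
    using bounded_linear.sums[OF ip.bounded_linear_right span_proj_sums, of u v]
    by (simp add: ip_smul_right mult.commute)
  then show ?thesis using ip_span_proj by (rule sums_unique2[rotated])
qed

lemma span_proj_smul: "span_proj g (smul c u) = smul c (span_proj g u)"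
  using bounded_linear.sums[OF smul.bounded_linear_right span_proj_sums, of c u]
    span_proj_sums[of "smul c u"]
  by (auto simp: ip_smul_left smul_smul intro: sums_unique2)

lemma span_proj_idem: "span_proj g (span_proj g u) = span_proj g u"
proof -
  have "ip (span_proj g u) (g m) = ip u (g m)" for m
  proof -
    have "(\<lambda>n. ip u (g n) * ip (g n) (g m)) = (\<lambda>n. if n = m then ip u (g n) else 0)"
      using g by (auto simp: orthonormal_or_zero_def ip.zero_right)
    then show ?thesis
      using ip_span_proj[of u "g m"] sums_single[of m "\<lambda>n. ip u (g n)"] sums_unique2 by metis
  qed
  then show ?thesis by (simp add: span_proj_def)
qed

lemma orthogonal_projection_span_proj:
  "orthogonal_projection smul ip (Blinfun (span_proj g))"
  unfolding orthogonal_projection_def bounded_linear_Blinfun_apply[OF bounded_linear_span_proj]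
  by (simp add: span_proj_smul span_proj_idem span_proj_selfadjoint)

end

lemma orthogonal_projection_complement:
  assumes "orthogonal_projection smul ip T"
  shows "orthogonal_projection smul ip (id_blinfun - T)"
  using assms unfolding orthogonal_projection_def
  by (auto simp: blinfun.diff_left blinfun.diff_right smul.diff_right ip.diff_left ip.diff_right)

text \<open>
  The vectors of the construction are real combinations of the basis, so their scalar products
  are real and the computations with \<open>inner\<close> also hold for \<open>ip\<close>.
\<close>

lemma ip_eq_inner_on_real_span:
  assumes e: "\<And>i j. ip (e i) (e j) = (if i = j then 1 else 0)"
    and x: "x \<in> span (range e)" and y: "y \<in> span (range e)"
  shows "ip x y = of_real (inner x y)"
  using x
proof (induction rule: span_induct)
  case base
  show ?case
    by (auto simp: subspace_def ip.zero_left ip.add_left ip.scaleR_left inner_add_left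
        scaleR_conv_of_real)
next
  case (step x)
  show ?case
    using y
  proof (induction rule: span_induct)
    case base
    show ?case
      by (auto simp: subspace_def ip.zero_right ip.add_right ip.scaleR_right inner_add_right
          scaleR_conv_of_real)
  next
    case (step y)
    with \<open>x \<in> range e\<close> obtain i j where "x = e i" "y = e j" by auto
    then have "ip x y = of_real (if i = j then 1 else 0)" by (simp add: e)
    then show ?case using inner_eq_of_ip by metis
  qed
qed

lemma retained_vec_in_span: "retained_vec e d n \<in> span (range e)"
proof -
  have e: "e k \<in> span (range e)" for k
    by (rule span_base) simp
  have "carry_vec e d n \<in> span (range e)"
    by (induction n) (simp_all add: e span_add span_scale)
  then show ?thesis
    by (simp add: retained_vec_def settled_vec_def span_zero e span_diff span_scale)
qed

section \<open>The measurable selection\<close>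

context
  fixes M :: "'x measure" and f :: "nat \<Rightarrow> 'x \<Rightarrow> real"
  assumes f [measurable]: "\<And>i. f i \<in> borel_measurable M"
begin

lemma measurable_carry [measurable]: "(\<lambda>x. carry (\<lambda>i. f i x) n) \<in> borel_measurable M"
  by (induction n) simp_all

lemma measurable_overflow [measurable]: "Measurable.pred M (\<lambda>x. overflow (\<lambda>i. f i x) n)"
  unfolding overflow_def by measurable

lemma measurable_cos_sq [measurable]: "(\<lambda>x. cos_sq (\<lambda>i. f i x) n) \<in> borel_measurable M"
  unfolding cos_sq_def by measurable

lemma measurable_mostly_high [measurable]: "Measurable.pred M (\<lambda>x. mostly_high (\<lambda>i. f i x))"
  unfolding mostly_high_def by measurable

lemma measurable_ip_carry_vec [measurable]:
  "(\<lambda>x. ip u (carry_vec e (\<lambda>i. f i x) n)) \<in> borel_measurable M"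
  "(\<lambda>x. ip (carry_vec e (\<lambda>i. f i x) n) u) \<in> borel_measurable M"
  by (induction n) (simp_all add: ip.add_left ip.add_right ip.scaleR_left ip.scaleR_right)

lemma measurable_ip_retained_vec [measurable]:
  "(\<lambda>x. ip u (retained_vec e (\<lambda>i. f i x) n)) \<in> borel_measurable M"
  "(\<lambda>x. ip (retained_vec e (\<lambda>i. f i x) n) u) \<in> borel_measurable M"
  unfolding retained_vec_def settled_vec_def if_distrib[of "ip u"] if_distrib[of "\<lambda>v. ip v u"]
    ip.diff_left ip.diff_right ip.scaleR_left ip.scaleR_right ip.zero_left ip.zero_right
  by measurable

end

text \<open>
  The projection is the series over the chosen orthonormal vectors, or its complement; the
  measurability of its matrix coefficients is that of the terms of the series and of the set
  where the complement is taken.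
\<close>

theorem measurable_carpenter:
  fixes M :: "'x measure" and f :: "nat \<Rightarrow> 'x \<Rightarrow> real"
  assumes e: "\<And>i j. ip (e i) (e j) = (if i = j then 1 else 0)"
    and f [measurable]: "\<And>i. f i \<in> borel_measurable M"
    and f01: "\<And>i x. x \<in> space M \<Longrightarrow> f i x \<in> {0..1}"
    and kad: "\<And>x. x \<in> space M \<Longrightarrow> kadison_condition (\<lambda>i. f i x)"
  shows "\<exists>P. measurable_projection M smul ip P \<and> has_diagonal M ip e P f"
proof -
  define g where "g x = retained_vec e (\<lambda>i. f i x)" for x
  define hi where "hi x \<longleftrightarrow> mostly_high (\<lambda>i. f i x)" for x
  define Q where "Q x = Blinfun (span_proj (g x))" for x
  define P where "P x = (if hi x then id_blinfun - Q x else Q x)" for x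
  have e_inner: "inner (e i) (e j) = (if i = j then 1 else 0)" for i j
    by (rule inner_eq_of_ip) (simp add: e)
  have g_e: "ip (g x n) (e i) = of_real (inner (g x n) (e i))"
      "ip (e i) (g x n) = of_real (inner (g x n) (e i))" for x n i
    unfolding g_def
    by (subst ip_eq_inner_on_real_span[OF e]; auto simp: retained_vec_in_span span_base inner_commute)+
  have g: "orthonormal_or_zero (g x)" if "x \<in> space M" for x
    unfolding orthonormal_or_zero_def
  proof (intro allI)
    fix m n
    have "ip (g x m) (g x n) = of_real (inner (g x m) (g x n))"
      unfolding g_def by (intro ip_eq_inner_on_real_span[OF e] retained_vec_in_span)
    also have "inner (g x m) (g x n) = (if m = n \<and> g x m \<noteq> 0 then 1 else 0)"
      unfolding g_def retained_vec_def
      using settled_vec_orthonormal[where e = e and d = "\<lambda>i. f i x" and m = n and n = n, OF e_inner f01[OF that]]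
        settled_vec_orthonormal[where e = e and d = "\<lambda>i. f i x" and m = m and n = n, OF e_inner f01[OF that]]
      by auto
    finally show "ip (g x m) (g x n) = (if m = n \<and> g x m \<noteq> 0 then 1 else 0)"
      by (simp only: if_distrib[of of_real] of_real_1 of_real_0)
  qed
  have Q_apply: "Q x u = span_proj (g x) u" if "x \<in> space M" for x u
    unfolding Q_def by (simp add: bounded_linear_Blinfun_apply bounded_linear_span_proj g that)
  have P_apply: "ip (P x u) v = (if hi x then ip u v - ip (Q x u) v else ip (Q x u) v)" for x u v
    by (simp add: P_def blinfun.diff_left ip.diff_left)
  have [measurable]: "Measurable.pred M hi"
    unfolding hi_def by measurable
  have Q_measurable [measurable]: "(\<lambda>x. ip (Q x u) v) \<in> borel_measurable M" for u v
  proof (rule borel_measurable_LIMSEQ_metric)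
    show "(\<lambda>x. \<Sum>k<n. ip u (g x k) * ip (g x k) v) \<in> borel_measurable M" for n
      unfolding g_def by measurable
    show "(\<lambda>n. \<Sum>k<n. ip u (g x k) * ip (g x k) v) \<longlonglongrightarrow> ip (Q x u) v" if "x \<in> space M" for x
      using ip_span_proj[OF g[OF that], of u v] by (simp add: sums_def Q_apply that)
  qed
  have "measurable_projection M smul ip P"
    unfolding measurable_projection_def
  proof (intro conjI ballI allI)
    show "orthogonal_projection smul ip (P x)" if "x \<in> space M" for x
      using orthogonal_projection_span_proj[OF g[OF that]] orthogonal_projection_complement
      by (simp add: P_def Q_def)
    show "(\<lambda>x. ip (P x u) v) \<in> borel_measurable M" for u v
      unfolding P_apply by measurable
  qed
  moreover have "has_diagonal M ip e P f"
    unfolding has_diagonal_def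
  proof (intro ballI allI)
    fix x i assume x: "x \<in> space M"
    have "(\<lambda>n. of_real ((inner (g x n) (e i))\<^sup>2) :: 'k) sums of_real (if hi x then 1 - f i x else f i x)"
      unfolding g_def hi_def
      by (intro sums_of_real retained_vec_diagonal e_inner f01 kad x)
    moreover have "(\<lambda>n. of_real ((inner (g x n) (e i))\<^sup>2)) sums ip (Q x (e i)) (e i)"
      using ip_span_proj[OF g[OF x], of "e i" "e i"]
      by (simp add: g_e Q_apply x power2_eq_square)
    ultimately have "ip (Q x (e i)) (e i) = of_real (if hi x then 1 - f i x else f i x)"
      by (rule sums_unique2[rotated])
    then show "ip (P x (e i)) (e i) = of_real (f i x)"
      by (simp add: P_apply e)
  qed
  ultimately show ?thesis by blast
qed

end

section \<open>Real and complex Hilbert spaces\<close>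

lemma scalar_product_space_real:
  "scalar_product_space (scaleR :: real \<Rightarrow> 'r \<Rightarrow> 'r::{real_inner, complete_space}) inner"
  by (rule scalar_product_space.intro)
    (auto simp: bounded_bilinear_scaleR bounded_bilinear_inner inner_commute)

lemma cinner_scaleC_right: "cinner x (scaleC c y) = cnj c * cinner x y"
  for x y :: "'c::complex_inner"
  by (metis cinner_commute cinner_scaleC_left complex_cnj_mult)

lemma cinner_add_right: "cinner x (y + z) = cinner x y + cinner x z"
  for x y z :: "'c::complex_inner"
  by (metis cinner_commute cinner_add_left complex_cnj_add)

lemma norm_scaleC: "norm (scaleC c x) = cmod c * norm x"
  for x :: "'c::complex_inner"
proof -
  have "complex_of_real ((norm (scaleC c x))\<^sup>2) = (c * cnj c) * complex_of_real ((norm x)\<^sup>2)"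
    unfolding cinner_self[symmetric] by (simp add: cinner_scaleC_left cinner_scaleC_right)
  also have "\<dots> = complex_of_real ((cmod c * norm x)\<^sup>2)"
    by (simp add: power_mult_distrib flip: complex_norm_square)
  finally have "(norm (scaleC c x))\<^sup>2 = (cmod c * norm x)\<^sup>2"
    unfolding of_real_eq_iff .
  then show ?thesis by (simp add: power2_eq_iff_nonneg)
qed

text \<open>
  The factor 2 spares the complex Cauchy-Schwarz inequality: the real and the imaginary part are
  real inner products, and any bound yields the continuity of \<open>cinner\<close>.
\<close>

lemma norm_cinner_le: "cmod (cinner x y) \<le> norm x * norm y * 2"
  for x y :: "'c::complex_inner"
proof -
  have "Im (cinner x y) = - inner (scaleC \<i> x) y"
    by (simp add: inner_eq_Re_cinner cinner_scaleC_left)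
  then have "\<bar>Im (cinner x y)\<bar> \<le> norm (scaleC \<i> x) * norm y"
    using Cauchy_Schwarz_ineq2[of "scaleC \<i> x" y] by simp
  moreover have "\<bar>Re (cinner x y)\<bar> \<le> norm x * norm y"
    using Cauchy_Schwarz_ineq2[of x y] by (simp add: inner_eq_Re_cinner)
  ultimately show ?thesis
    using cmod_le[of "cinner x y"] by (simp add: norm_scaleC)
qed

lemma scalar_product_space_complex:
  "scalar_product_space (scaleC :: complex \<Rightarrow> 'c \<Rightarrow> 'c::complex_hilbert_space) cinner"
proof (rule scalar_product_space.intro)
  show "bounded_bilinear (scaleC :: complex \<Rightarrow> 'c \<Rightarrow> 'c)"
    by (intro bounded_bilinear.intro exI[of _ 1])
      (auto simp: scaleC_add_left scaleC_add_right scaleR_scaleC scaleC_scaleC norm_scaleC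
        scaleR_conv_of_real mult.commute)
  show "bounded_bilinear (cinner :: 'c \<Rightarrow> 'c \<Rightarrow> complex)"
    by (intro bounded_bilinear.intro exI[of _ 2])
      (auto simp: cinner_add_left cinner_add_right scaleR_scaleC cinner_scaleC_left
        cinner_scaleC_right scaleR_conv_of_real norm_cinner_le)
qed (auto simp: scaleC_scaleC cinner_scaleC_left cinner_scaleC_right
    inner_eq_Re_cinner simp flip: cinner_commute)

lemma infsum_ennreal_eq_suminf:
  "(\<Sum>\<^sub>\<infinity>i\<in>{i. Q i}. ennreal (h i)) = (\<Sum>i. ennreal (if Q i then h i else 0))" for h :: "nat \<Rightarrow> real"
proof -
  have "(\<Sum>\<^sub>\<infinity>i\<in>{i. Q i}. ennreal (h i)) = (\<Sum>\<^sub>\<infinity>i. ennreal (if Q i then h i else 0))"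
    by (rule infsum_cong_neutral) auto
  also have "\<dots> = (\<Sum>i. ennreal (if Q i then h i else 0))"
    by (intro sums_unique has_sum_imp_sums has_sum_infsum nonneg_summable_on_complete) auto
  finally show ?thesis .
qed

lemma summable_iff_suminf_ennreal_finite:
  assumes "\<And>i. 0 \<le> h i"
  shows "summable h \<longleftrightarrow> (\<Sum>i. ennreal (h i)) < \<infinity>"
proof
  assume "summable h"
  from suminf_ennreal2[OF assms this] show "(\<Sum>i. ennreal (h i)) < \<infinity>" by simp
next
  assume "(\<Sum>i. ennreal (h i)) < \<infinity>"
  then show "summable h"
    by (intro summable_suminf_not_top assms) simp
qed

text \<open>
  If \<open>min (f i x) (1 - f i x)\<close> were summable, then by comparison both parts would be.
\<close>

lemma kadison_condition_of_sums:
  assumes d: "\<And>i. f i x \<in> {0..1}"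
    and "(lower_sum f x = \<infinity> \<or> upper_sum f x = \<infinity>) \<or>
      (lower_sum f x < \<infinity> \<and> upper_sum f x < \<infinity> \<and>
        enn2real (lower_sum f x) - enn2real (upper_sum f x) \<in> \<int>)"
  shows "kadison_condition (\<lambda>i. f i x)"
proof -
  let ?l = "lower_part (\<lambda>i. f i x)" and ?u = "upper_part (\<lambda>i. f i x)"
  have nonneg: "0 \<le> ?l i" "0 \<le> ?u i" for i
    using d[of i] by (auto simp: lower_part_def upper_part_def)
  have lower: "lower_sum f x = (\<Sum>i. ennreal (?l i))" and upper: "upper_sum f x = (\<Sum>i. ennreal (?u i))"
    unfolding lower_sum_def upper_sum_def lower_part_def upper_part_def
    by (rule infsum_ennreal_eq_suminf)+
  show ?thesis
  proof (cases "summable ?l \<and> summable ?u")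
    case True
    then have fin: "lower_sum f x < \<infinity>" "upper_sum f x < \<infinity>"
      unfolding lower upper using summable_iff_suminf_ennreal_finite nonneg by blast+
    have "enn2real (lower_sum f x) = suminf ?l" "enn2real (upper_sum f x) = suminf ?u"
      unfolding lower upper using True nonneg
      by (simp_all only: suminf_ennreal2 suminf_nonneg enn2real_ennreal)
    with fin show ?thesis
      using assms(2) True unfolding kadison_condition_def by auto
  next
    case False
    have "summable ?l \<and> summable ?u" if s: "summable (\<lambda>i. min (f i x) (1 - f i x))"
      using d by (auto simp: lower_part_def upper_part_def intro!: summable_comparison_test'[OF s, of 0])
    with False show ?thesis unfolding kadison_condition_def by blast
  qed
qed

theorem theorem1p2:
  fixes M :: "'x measure"
    and f :: "nat \<Rightarrow> 'x \<Rightarrow> real"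
  assumes "\<And>i. f i \<in> borel_measurable M"
    and "\<And>i x. x \<in> space M \<Longrightarrow> f i x \<in> {0..1}"
    and "\<And>x. x \<in> space M \<Longrightarrow>
      (lower_sum f x = \<infinity> \<or> upper_sum f x = \<infinity>) \<or>
      (lower_sum f x < \<infinity> \<and> upper_sum f x < \<infinity> \<and>
        enn2real (lower_sum f x) - enn2real (upper_sum f x) \<in> \<int>)"
  shows
    "(\<forall>e :: nat \<Rightarrow> 'r::{real_inner, complete_space}.
        orthonormal_basis scaleR inner e \<longrightarrow>
        (\<exists>P. measurable_projection M scaleR inner P \<and> has_diagonal M inner e P f)) \<and>
     (\<forall>e :: nat \<Rightarrow> 'c::complex_hilbert_space.
        orthonormal_basis scaleC cinner e \<longrightarrow>
        (\<exists>P. measurable_projection M scaleC cinner P \<and> has_diagonal M cinner e P f))"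
proof (intro conjI allI impI)
  have kad: "kadison_condition (\<lambda>i. f i x)" if "x \<in> space M" for x
    by (rule kadison_condition_of_sums[OF assms(2)[OF that] assms(3)[OF that]])
  show "\<exists>P. measurable_projection M scaleR inner P \<and> has_diagonal M inner e P f"
    if "orthonormal_basis scaleR inner e" for e :: "nat \<Rightarrow> 'r"
    using that unfolding orthonormal_basis_def
    by (intro scalar_product_space.measurable_carpenter[OF scalar_product_space_real]
        assms(1,2) kad) auto
  show "\<exists>P. measurable_projection M scaleC cinner P \<and> has_diagonal M cinner e P f"
    if "orthonormal_basis scaleC cinner e" for e :: "nat \<Rightarrow> 'c"
    using that unfolding orthonormal_basis_def
    by (intro scalar_product_space.measurable_carpenter[OF scalar_product_space_complex]
        assms(1,2) kad) auto
qed

end
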